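(* Let $G$ be a symmetric positive definite $24\times24$ real matrix, $\bar b,\bar\lambda\in\mathbb{R}^{24}$, $c\in\mathbb{R}$, and for $\pi\in\mathbb{R}^{24}$ let $$\overline{\mathrm{cs}}(\pi)=\tfrac12\pi^{\mathsf T}G\pi-\pi^{\mathsf T}\bar b+c,\qquad \overline{\mathrm{rp}}(\pi)=(\pi-\bar\lambda)^{\mathsf T}(-G\pi+\bar b),\qquad \overline{\mathrm{sw}}(\pi)=\overline{\mathrm{rp}}(\pi)+\overline{\mathrm{cs}}(\pi).$$ Then the price vector $\pi^{\mathrm{sw}}$ that maximizes $\overline{\mathrm{sw}}$ over $\mathbb{R}^{24}$ is $\pi^{\mathrm{sw}}=\bar\lambda$, and $\overline{\mathrm{rp}}(\pi^{\mathrm{sw}})=0$. Moreover, for every $\pi'\in\mathbb{R}^{24}$ with $\overline{\mathrm{rp}}(\pi')\ge 0$ one has $\overline{\mathrm{cs}}(\pi')\le\overline{\mathrm{cs}}(\pi^{\mathrm{sw}})$.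
   Context: Interpretation: $\pi$ is the day-ahead hourly retail price vector, $-G\pi+\bar b$ is the expected aggregated demand of consumers responding optimally to $\pi$, $\bar\lambda$ is the expected vector of hourly marginal retail costs, $\overline{\mathrm{cs}}$ is the expected total consumer surplus, $\overline{\mathrm{rp}}$ the expected retail profit, and $\overline{\mathrm{sw}}$ the expected social welfare. *)

theory Defs
  imports "HOL-Analysis.Analysis"
begin

definition pos_def_matrix :: "real ^ 'n ^ 'n \<Rightarrow> bool" where
  "pos_def_matrix A \<longleftrightarrow> (\<forall>x. x \<noteq> 0 \<longrightarrow> x \<bullet> (A *v x) > 0)"

text \<open>
  \<open>p\<close> is the day-ahead hourly price vector and \<open>- (G *v p) + b\<close> the expected aggregated
  demand of consumers responding optimally to it; \<open>l\<close> is the expected vector of hourly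
  marginal retail costs. The functions below are the expected total consumer surplus,
  the expected retail profit and the expected social welfare.
\<close>

definition consumer_surplus ::
  "real ^ 'n ^ 'n \<Rightarrow> real ^ 'n \<Rightarrow> real \<Rightarrow> real ^ 'n \<Rightarrow> real" where
  "consumer_surplus G b c p = (1 / 2) * (p \<bullet> (G *v p)) - p \<bullet> b + c"

definition retail_profit ::
  "real ^ 'n ^ 'n \<Rightarrow> real ^ 'n \<Rightarrow> real ^ 'n \<Rightarrow> real ^ 'n \<Rightarrow> real" where
  "retail_profit G b l p = (p - l) \<bullet> (- (G *v p) + b)"

definition social_welfare ::
  "real ^ 'n ^ 'n \<Rightarrow> real ^ 'n \<Rightarrow> real \<Rightarrow> real ^ 'n \<Rightarrow> real ^ 'n \<Rightarrow> real" where
  "social_welfare G b c l p = retail_profit G b l p + consumer_surplus G b c p"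

end

theory Submission
  imports Defs
begin

text \<open>
  Completing the square, the welfare falls short of its value at \<open>l\<close> by half the \<open>G\<close>-norm
  squared of \<open>p - l\<close>. The profit vanishes at \<open>l\<close>, so a price with nonnegative profit has
  surplus at most its welfare, hence at most the welfare at \<open>l\<close>, which is the surplus there.
\<close>

text \<open>Moving \<open>G\<close> across the inner product transposes it.\<close>

lemma inner_matrix_vector_sym:
  fixes G :: "real ^ 'n ^ 'n"
  assumes "transpose G = G"
  shows "x \<bullet> (G *v y) = y \<bullet> (G *v x)"
  by (metis assms dot_lmul_matrix inner_commute transpose_matrix_vector)

text \<open>The \<open>p \<bullet> b\<close> terms of profit and surplus cancel; symmetry of
  \<open>G\<close> then merges the cross terms \<open>l \<bullet> (G *v p)\<close> and
  \<open>p \<bullet> (G *v l)\<close> into those of the square.\<close>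

lemma social_welfare_deficit:
  fixes G :: "real ^ 'n ^ 'n"
  assumes "transpose G = G"
  shows "social_welfare G b c l p = social_welfare G b c l l - (1 / 2) * ((p - l) \<bullet> (G *v (p - l)))"
  using inner_matrix_vector_sym[OF assms, of l p]
  by (simp add: social_welfare_def retail_profit_def consumer_surplus_def
      matrix_vector_mult_diff_distrib inner_diff_left inner_diff_right inner_add_right field_simps)

lemma social_welfare_less:
  fixes G :: "real ^ 'n ^ 'n"
  assumes "transpose G = G" and "pos_def_matrix G" and "p \<noteq> l"
  shows "social_welfare G b c l p < social_welfare G b c l l"
  using assms(2,3) social_welfare_deficit[OF assms(1), of b c l p]
  by (simp add: pos_def_matrix_def)

lemma retail_profit_cost [simp]: "retail_profit G b l l = 0"
  by (simp add: retail_profit_def)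

theorem theorem2:
  fixes G :: "real ^ 24 ^ 24" and b l :: "real ^ 24" and c :: real
  assumes "transpose G = G" and "pos_def_matrix G"
  shows "\<exists>p_sw. (\<forall>p. is_arg_max (social_welfare G b c l) (\<lambda>_. True) p \<longleftrightarrow> p = p_sw)
      \<and> p_sw = l
      \<and> retail_profit G b l p_sw = 0
      \<and> (\<forall>p'. retail_profit G b l p' \<ge> 0 \<longrightarrow>
              consumer_surplus G b c p' \<le> consumer_surplus G b c p_sw)"
proof (intro exI conjI allI impI)
  note less = social_welfare_less[OF assms, of _ l b c]
  show "is_arg_max (social_welfare G b c l) (\<lambda>_. True) p \<longleftrightarrow> p = l" for p
    \<comment> \<open>\<open>is_arg_max\<close> only says that no point has a larger value; as
      \<open>less\<close> is strict, \<open>l\<close> beats every other \<open>p\<close>, which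
      gives uniqueness.\<close>
    unfolding is_arg_max_def using less by (metis less_asym)
  show "consumer_surplus G b c p \<le> consumer_surplus G b c l" if "retail_profit G b l p \<ge> 0" for p
  proof (cases "p = l")
    case False
    then show ?thesis
      using less[OF False] that by (simp add: social_welfare_def)
  qed simp
qed simp_all

end
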